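(* Let $\alpha=\frac{1-q}{1+ac+a+c}$. For all integers $N\ge0$ and $r\ge0$, $$\langle W|D^N|V^r\rangle\cdot\alpha^r(1-q)^r=[y^r]\,\frac{\langle W|(D+y\alpha A)^N|V\rangle}{\langle W|A^r|V\rangle}.$$
   Context: Fix generic complex parameters $a,b,c,d,q$. For integers $n\ge0$ define $\mathcal{A}_n=\frac{(1-q^{n-1}abcd)(1-q^{n+1})(1-q^nab)(1-q^nac)(1-q^nad)(1-q^nbc)(1-q^nbd)(1-q^ncd)}{(1-q^{2n-1}abcd)(1-q^{2n}abcd)^2(1-q^{2n+1}abcd)}$, $d_n^\natural=\frac{q^{n-1}}{(1-q^{2n-2}abcd)(1-q^{2n}abcd)}\big[bd(a+c)+(b+d)q-abcd(b+d)q^{n-1}-\{bd(a+c)+abcd(b+d)\}q^n-bd(a+c)q^{n+1}+ab^2cd^2(a+c)q^{2n-1}+abcd(b+d)q^{2n}\big]$, $e_n^\natural=\frac{q^{n-1}}{(1-q^{2n-2}abcd)(1-q^{2n}abcd)}\big[ac(b+d)+(a+c)q-abcd(a+c)q^{n-1}-\{ac(b+d)+abcd(a+c)\}q^n-ac(b+d)q^{n+1}+a^2bc^2d(b+d)q^{2n-1}+abcd(a+c)q^{2n}\big]$, $d_n^\sharp=1$, $d_n^\flat=-\frac{q^nbd}{(1-q^nac)(1-q^nbd)}\mathcal{A}_n$, $e_n^\sharp=-q^nac$, $e_n^\flat=\frac{\mathcal{A}_n}{(1-q^nac)(1-q^nbd)}$. Let $\mathsf d,\mathsf e$ be the infinite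 tridiagonal matrices indexed by $\{0,1,\dots\}$ with nonzero entries $\mathsf d_{n,n}=d_n^\natural$, $\mathsf d_{n,n+1}=d_n^\sharp$, $\mathsf d_{n+1,n}=d_n^\flat$, and similarly for $\mathsf e$. Put $D=\frac{1}{1-q}(I+\mathsf d)$, $E=\frac{1}{1-q}(I+\mathsf e)$, $A=DE-ED$. Let $\langle W|=(1,0,0,\dots)$, $|V\rangle=\langle W|^T$, and $|V^r\rangle$ the column vector with $1$ in position $r$ (positions indexed from $0$) and $0$ elsewhere. $[y^r]$ denotes the coefficient of $y^r$. *)

theory Defs
  imports Complex_Main "HOL-Library.Groups_Big_Fun" "HOL-Computational_Algebra.Polynomial"
begin

text \<open>
  Matrices and vectors indexed by the natural numbers. Products are formed with
  \<^const>\<open>Sum_any\<close>, the sum over the support; it is the true sum for the matrices used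
  here, since these are banded and all the supports involved are therefore finite.
\<close>

type_synonym 'a imat = "nat \<Rightarrow> nat \<Rightarrow> 'a"
type_synonym 'a ivec = "nat \<Rightarrow> 'a"

definition imat_one :: "'a::comm_ring_1 imat" where
  "imat_one = (\<lambda>i j. if i = j then 1 else 0)"

definition imat_mult :: "'a::comm_ring_1 imat \<Rightarrow> 'a imat \<Rightarrow> 'a imat" where
  "imat_mult M N = (\<lambda>i j. Sum_any (\<lambda>k. M i k * N k j))"

primrec imat_pow :: "'a::comm_ring_1 imat \<Rightarrow> nat \<Rightarrow> 'a imat" where
  "imat_pow M 0 = imat_one"
| "imat_pow M (Suc n) = imat_mult (imat_pow M n) M"

definition bracket :: "'a::comm_ring_1 ivec \<Rightarrow> 'a imat \<Rightarrow> 'a ivec \<Rightarrow> 'a" where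
  "bracket w M v = Sum_any (\<lambda>i. Sum_any (\<lambda>j. w i * M i j * v j))"

definition tridiag :: "(nat \<Rightarrow> 'a) \<Rightarrow> (nat \<Rightarrow> 'a) \<Rightarrow> (nat \<Rightarrow> 'a) \<Rightarrow> 'a::comm_ring_1 imat" where
  "tridiag diag upper lower = (\<lambda>i j.
     if j = i then diag i
     else if j = Suc i then upper i
     else if i = Suc j then lower j
     else 0)"

definition vec_V :: "nat \<Rightarrow> 'a::comm_ring_1 ivec" where
  "vec_V r = (\<lambda>i. if i = r then 1 else 0)"

abbreviation vec_W :: "'a::comm_ring_1 ivec" where
  "vec_W \<equiv> vec_V 0"

definition cal_A :: "complex \<Rightarrow> complex \<Rightarrow> complex \<Rightarrow> complex \<Rightarrow> complex \<Rightarrow> nat \<Rightarrow> complex" where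
  "cal_A a b c d q n =
     ((1 - q powi (int n - 1) * (a*b*c*d)) * (1 - q ^ (n + 1))
       * (1 - q ^ n * (a*b)) * (1 - q ^ n * (a*c)) * (1 - q ^ n * (a*d))
       * (1 - q ^ n * (b*c)) * (1 - q ^ n * (b*d)) * (1 - q ^ n * (c*d)))
     / ((1 - q powi (2 * int n - 1) * (a*b*c*d)) * (1 - q ^ (2*n) * (a*b*c*d)) ^ 2
       * (1 - q ^ (2*n + 1) * (a*b*c*d)))"

definition d_nat :: "complex \<Rightarrow> complex \<Rightarrow> complex \<Rightarrow> complex \<Rightarrow> complex \<Rightarrow> nat \<Rightarrow> complex" where
  "d_nat a b c d q n =
     q powi (int n - 1)
     / ((1 - q powi (2 * int n - 2) * (a*b*c*d)) * (1 - q ^ (2*n) * (a*b*c*d)))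
     * (b*d*(a + c) + (b + d) * q
        - a*b*c*d*(b + d) * q powi (int n - 1)
        - (b*d*(a + c) + a*b*c*d*(b + d)) * q ^ n
        - b*d*(a + c) * q ^ (n + 1)
        + a*b^2*c*d^2*(a + c) * q powi (2 * int n - 1)
        + a*b*c*d*(b + d) * q ^ (2*n))"

definition e_nat :: "complex \<Rightarrow> complex \<Rightarrow> complex \<Rightarrow> complex \<Rightarrow> complex \<Rightarrow> nat \<Rightarrow> complex" where
  "e_nat a b c d q n =
     q powi (int n - 1)
     / ((1 - q powi (2 * int n - 2) * (a*b*c*d)) * (1 - q ^ (2*n) * (a*b*c*d)))
     * (a*c*(b + d) + (a + c) * q
        - a*b*c*d*(a + c) * q powi (int n - 1)
        - (a*c*(b + d) + a*b*c*d*(a + c)) * q ^ n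
        - a*c*(b + d) * q ^ (n + 1)
        + a^2*b*c^2*d*(b + d) * q powi (2 * int n - 1)
        + a*b*c*d*(a + c) * q ^ (2*n))"

definition d_flat :: "complex \<Rightarrow> complex \<Rightarrow> complex \<Rightarrow> complex \<Rightarrow> complex \<Rightarrow> nat \<Rightarrow> complex" where
  "d_flat a b c d q n =
     - (q ^ n * b * d / ((1 - q ^ n * (a*c)) * (1 - q ^ n * (b*d)))) * cal_A a b c d q n"

definition e_flat :: "complex \<Rightarrow> complex \<Rightarrow> complex \<Rightarrow> complex \<Rightarrow> complex \<Rightarrow> nat \<Rightarrow> complex" where
  "e_flat a b c d q n = cal_A a b c d q n / ((1 - q ^ n * (a*c)) * (1 - q ^ n * (b*d)))"

definition d_mat :: "complex \<Rightarrow> complex \<Rightarrow> complex \<Rightarrow> complex \<Rightarrow> complex \<Rightarrow> complex imat" where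
  "d_mat a b c d q = tridiag (d_nat a b c d q) (\<lambda>n. 1) (d_flat a b c d q)"

definition e_mat :: "complex \<Rightarrow> complex \<Rightarrow> complex \<Rightarrow> complex \<Rightarrow> complex \<Rightarrow> complex imat" where
  "e_mat a b c d q = tridiag (e_nat a b c d q) (\<lambda>n. - (q ^ n) * a * c) (e_flat a b c d q)"

definition D_mat :: "complex \<Rightarrow> complex \<Rightarrow> complex \<Rightarrow> complex \<Rightarrow> complex \<Rightarrow> complex imat" where
  "D_mat a b c d q = (\<lambda>i j. 1 / (1 - q) * (imat_one i j + d_mat a b c d q i j))"

definition E_mat :: "complex \<Rightarrow> complex \<Rightarrow> complex \<Rightarrow> complex \<Rightarrow> complex \<Rightarrow> complex imat" where
  "E_mat a b c d q = (\<lambda>i j. 1 / (1 - q) * (imat_one i j + e_mat a b c d q i j))"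

definition A_mat :: "complex \<Rightarrow> complex \<Rightarrow> complex \<Rightarrow> complex \<Rightarrow> complex \<Rightarrow> complex imat" where
  "A_mat a b c d q = (\<lambda>i j.
     imat_mult (D_mat a b c d q) (E_mat a b c d q) i j
     - imat_mult (E_mat a b c d q) (D_mat a b c d q) i j)"

text \<open>
  Matrices over \<open>complex poly\<close> carry the formal variable \<open>y\<close>: the entries of
  \<open>y_pencil M K\<close> are those of \<open>M + y K\<close>.
\<close>

definition y_pencil :: "complex imat \<Rightarrow> complex imat \<Rightarrow> complex poly imat" where
  "y_pencil M K = (\<lambda>i j. [:M i j:] + monom 1 1 * [:K i j:])"

text \<open>
  Genericity of the parameters. The conditions on \<open>q\<close>, on \<open>1 + ac + a + c\<close>, on \<open>abcd\<close>,
  on \<open>ac\<close> and on \<open>bd\<close> say that the denominators occurring in the matrix entries and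
  in the scalar \<open>\<alpha>\<close> do not vanish (the exponent \<open>-2\<close> comes from the diagonal entries with index
  \<open>0\<close>). The conditions on \<open>ab\<close>, \<open>ad\<close>, \<open>bc\<close>, \<open>cd\<close> concern the denominator
  \<open>\<langle>W|A\<^sup>r|V\<rangle>\<close>, which vanishes for all large \<open>r\<close> if one of them fails: it equals
  the product over \<open>i < r\<close> of
  \<open>(1 - q\<^sup>i ab)(1 - q\<^sup>i ad)(1 - q\<^sup>i bc)(1 - q\<^sup>i cd) / (1 - q)\<close>, divided by the product
  over \<open>i < 2r\<close> of \<open>1 - q\<^sup>i abcd\<close>.
\<close>

definition generic_params :: "complex \<Rightarrow> complex \<Rightarrow> complex \<Rightarrow> complex \<Rightarrow> complex \<Rightarrow> bool" where
  "generic_params a b c d q \<longleftrightarrow>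
     q \<noteq> 0 \<and> q \<noteq> 1 \<and> 1 + a*c + a + c \<noteq> 0 \<and>
     (\<forall>k::int. k \<ge> -2 \<longrightarrow> 1 - q powi k * (a*b*c*d) \<noteq> 0) \<and>
     (\<forall>n::nat.
        1 - q ^ n * (a*b) \<noteq> 0 \<and> 1 - q ^ n * (a*c) \<noteq> 0 \<and> 1 - q ^ n * (a*d) \<noteq> 0 \<and>
        1 - q ^ n * (b*c) \<noteq> 0 \<and> 1 - q ^ n * (b*d) \<noteq> 0 \<and> 1 - q ^ n * (c*d) \<noteq> 0)"

end

theory Submission
  imports Defs
begin

text \<open>
  The scalar \<open>\<alpha>\<close> cancels. Write \<open>d\<close>, \<open>e\<close> for the tridiagonal matrices; they satisfy
  \<open>de - q ed = 1 - q\<close>, so \<open>A = (1 - ed) / (1 - q)\<close>, and \<open>B = 1 - ed\<close> satisfies \<open>dB = qBd\<close> and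
  \<open>Be = qeB\<close>. The noncommutative \<open>q\<close>-binomial theorem gives
  \<open>[y\<^sup>r] (d + yB)\<^sup>n = (n choose r)\<^sub>q B\<^sup>r d\<^sup>n\<^sup>-\<^sup>r\<close>, and \<open>D = (1 + d) / (1 - q)\<close> is handled by the
  ordinary binomial theorem. What remains is
  \<open>\<langle>W|d\<^sup>n|V\<^sup>r\<rangle> \<langle>W|B\<^sup>r|V\<rangle> = (n choose r)\<^sub>q \<langle>W|B\<^sup>r d\<^sup>n\<^sup>-\<^sup>r|V\<rangle>\<close>, proved by induction on \<open>n\<close>.
  With \<open>s = a + c\<close>, \<open>p = ac\<close>, \<open>t = b + d\<close>, \<open>u = bd\<close>, the boundary relations
  \<open>\<langle>W|e = \<langle>W|(s - p d)\<close> and \<open>d|V\<rangle> = (t - u e)|V\<rangle>\<close> yield contiguous relations between the numbers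
  \<open>\<langle>W|B\<^sup>r d\<^sup>k|V\<rangle>\<close>, which imply the recurrence in \<open>n\<close> read off from the entries of \<open>d\<close>.
\<close>

subsection \<open>Row-finite matrices as operators\<close>

definition act :: "'a::comm_ring_1 imat \<Rightarrow> 'a ivec \<Rightarrow> 'a ivec" where
  "act M v = (\<lambda>i. Sum_any (\<lambda>j. M i j * v j))"

definition row_finite :: "'a::comm_ring_1 imat \<Rightarrow> bool" where
  "row_finite M \<longleftrightarrow> (\<forall>i. finite {j. M i j \<noteq> 0})"

lemma act_eq_sum:
  assumes "finite A" "\<And>j. j \<notin> A \<Longrightarrow> M i j = 0"
  shows "act M v i = (\<Sum>j\<in>A. M i j * v j)"
  unfolding act_def by (rule Sum_any.expand_superset[OF assms(1)]) (use assms(2) in force)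

lemma imat_mult_eq_sum:
  assumes "finite A" "\<And>k. k \<notin> A \<Longrightarrow> M i k = 0"
  shows "imat_mult M N i j = (\<Sum>k\<in>A. M i k * N k j)"
  unfolding imat_mult_def by (rule Sum_any.expand_superset[OF assms(1)]) (use assms(2) in force)

lemma row_finiteI:
  assumes "\<And>i j. i + n < j \<Longrightarrow> M i j = 0"
  shows "row_finite M"
  unfolding row_finite_def
proof
  fix i
  have "{j. M i j \<noteq> 0} \<subseteq> {..i + n}" using assms not_le
    by (metis (mono_tags, lifting) atMost_iff mem_Collect_eq subsetI)
  then show "finite {j. M i j \<noteq> 0}" using finite_subset by blast
qed

lemma row_finite_mult:
  assumes "row_finite M" "row_finite N"
  shows "row_finite (imat_mult M N)"
  unfolding row_finite_def
proof
  fix i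
  let ?A = "{k. M i k \<noteq> 0}"
  have A: "finite ?A" using assms by (simp add: row_finite_def)
  have "{j. imat_mult M N i j \<noteq> 0} \<subseteq> (\<Union>k\<in>?A. {j. N k j \<noteq> 0})"
  proof
    fix j assume "j \<in> {j. imat_mult M N i j \<noteq> 0}"
    moreover have "imat_mult M N i j = (\<Sum>k\<in>?A. M i k * N k j)"
      by (rule imat_mult_eq_sum) (use A in auto)
    ultimately have "(\<Sum>k\<in>?A. M i k * N k j) \<noteq> 0" by simp
    then obtain k where "k \<in> ?A" "M i k * N k j \<noteq> 0"
      by (meson sum.not_neutral_contains_not_neutral)
    then show "j \<in> (\<Union>k\<in>?A. {j. N k j \<noteq> 0})" by auto
  qed
  moreover have "finite (\<Union>k\<in>?A. {j. N k j \<noteq> 0})"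
    using A assms(2) by (simp add: row_finite_def)
  ultimately show "finite {j. imat_mult M N i j \<noteq> 0}" by (rule finite_subset)
qed

lemma act_mult:
  assumes "row_finite M" "row_finite N"
  shows "act (imat_mult M N) v = act M (act N v)"
proof
  fix i
  let ?A = "{k. M i k \<noteq> 0}"
  let ?B = "\<Union>k\<in>?A. {j. N k j \<noteq> 0}"
  have A: "finite ?A" using assms by (simp add: row_finite_def)
  have B: "finite ?B" using A assms(2) by (simp add: row_finite_def)
  have MN: "imat_mult M N i j = (\<Sum>k\<in>?A. M i k * N k j)" for j
    by (rule imat_mult_eq_sum) (use A in auto)
  have "act (imat_mult M N) v i = (\<Sum>j\<in>?B. imat_mult M N i j * v j)"
    by (rule act_eq_sum[OF B]) (auto simp: MN intro!: sum.neutral)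
  also have "\<dots> = (\<Sum>k\<in>?A. M i k * (\<Sum>j\<in>?B. N k j * v j))"
    unfolding MN sum_distrib_right sum_distrib_left mult.assoc by (rule sum.swap)
  also have "\<dots> = (\<Sum>k\<in>?A. M i k * act N v k)"
    by (intro sum.cong refl arg_cong2[where f = "(*)"] act_eq_sum[symmetric] B) auto
  also have "\<dots> = act M (act N v) i"
    by (rule act_eq_sum[symmetric]) (use A in auto)
  finally show "act (imat_mult M N) v i = act M (act N v) i" .
qed

lemma row_finite_one: "row_finite imat_one"
  by (rule row_finiteI[of 0]) (simp add: imat_one_def)

lemma act_one: "act imat_one v = v"
proof
  show "act imat_one v i = v i" for i
    by (subst act_eq_sum[of "{i}"]) (auto simp: imat_one_def)
qed

lemma row_finite_pow: "row_finite M \<Longrightarrow> row_finite (imat_pow M n)"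
  by (induction n) (simp_all add: row_finite_one row_finite_mult)

lemma act_pow: "row_finite M \<Longrightarrow> act (imat_pow M n) v = (act M ^^ n) v"
  by (induction n arbitrary: v)
    (simp_all add: act_one act_mult row_finite_pow funpow_swap1)

lemma bracket_pow:
  assumes "row_finite M"
  shows "bracket vec_W (imat_pow M n) v = (act M ^^ n) v 0"
proof -
  have "bracket vec_W (imat_pow M n) v = act (imat_pow M n) v 0"
    unfolding bracket_def
    by (rule trans[OF Sum_any.expand_superset[of "{0}"]]) (auto simp: vec_V_def act_def)
  then show ?thesis by (simp add: act_pow assms)
qed

lemma row_finite_combination:
  assumes "row_finite M" "row_finite N"
  shows "row_finite (\<lambda>i j. x * M i j + y * N i j)"
  unfolding row_finite_def
proof
  fix i
  have "{j. x * M i j + y * N i j \<noteq> 0} \<subseteq> {j. M i j \<noteq> 0} \<union> {j. N i j \<noteq> 0}" by auto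
  then show "finite {j. x * M i j + y * N i j \<noteq> 0}"
    by (rule finite_subset) (use assms in \<open>simp add: row_finite_def\<close>)
qed

lemma act_combination:
  assumes "row_finite M" "row_finite N"
  shows "act (\<lambda>i j. x * M i j + y * N i j) v = (\<lambda>i. x * act M v i + y * act N v i)"
proof
  fix i
  let ?A = "{j. M i j \<noteq> 0} \<union> {j. N i j \<noteq> 0}"
  have A: "finite ?A" using assms by (simp add: row_finite_def)
  have "act M v i = (\<Sum>j\<in>?A. M i j * v j)" "act N v i = (\<Sum>j\<in>?A. N i j * v j)"
    "act (\<lambda>i j. x * M i j + y * N i j) v i = (\<Sum>j\<in>?A. (x * M i j + y * N i j) * v j)"
    by (rule act_eq_sum[OF A]; auto)+
  then show "act (\<lambda>i j. x * M i j + y * N i j) v i = x * act M v i + y * act N v i"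
    by (simp add: sum_distrib_left sum.distrib[symmetric] algebra_simps)
qed

definition linear_op :: "('a::comm_ring_1 ivec \<Rightarrow> 'a ivec) \<Rightarrow> bool" where
  "linear_op T \<longleftrightarrow> (\<forall>x y v w. T (\<lambda>i. x * v i + y * w i) = (\<lambda>i. x * T v i + y * T w i))"

lemma linear_op_act:
  assumes "row_finite M"
  shows "linear_op (act M)"
  unfolding linear_op_def
proof (intro allI ext)
  fix x y :: 'a and v w i
  let ?A = "{j. M i j \<noteq> 0}"
  have "act M v i = (\<Sum>j\<in>?A. M i j * v j)" for v
    by (rule act_eq_sum) (use assms in \<open>auto simp: row_finite_def\<close>)
  then show "act M (\<lambda>i. x * v i + y * w i) i = x * act M v i + y * act M w i"
    by (simp add: sum_distrib_left sum.distrib[symmetric] algebra_simps)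
qed

lemma linear_op_combination:
  "linear_op T \<Longrightarrow> T (\<lambda>i. x * v i + y * w i) = (\<lambda>i. x * T v i + y * T w i)"
  by (simp add: linear_op_def)

lemma linear_op_scale: "linear_op T \<Longrightarrow> T (\<lambda>i. x * v i) = (\<lambda>i. x * T v i)"
  using linear_op_combination[of T x v 0 v] by simp

lemma linear_op_add: "linear_op T \<Longrightarrow> T (\<lambda>i. v i + w i) = (\<lambda>i. T v i + T w i)"
  using linear_op_combination[of T 1 v 1 w] by simp

lemma linear_op_diff: "linear_op T \<Longrightarrow> T (\<lambda>i. v i - w i) = (\<lambda>i. T v i - T w i)"
  using linear_op_combination[of T 1 v "-1" w] by simp

lemma linear_op_funpow: "linear_op T \<Longrightarrow> linear_op (T ^^ n)"
  by (induction n) (simp_all add: linear_op_def)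

lemma linear_op_sum:
  assumes "linear_op T"
  shows "T (\<lambda>i. \<Sum>n\<in>A. x n * v n i) = (\<lambda>i. \<Sum>n\<in>A. x n * T (v n) i)"
proof (induction A rule: infinite_finite_induct)
  case (insert n A)
  then show ?case
    using linear_op_combination[OF assms, of "x n" "v n" 1 "\<lambda>i. \<Sum>n\<in>A. x n * v n i"] by simp
qed (use linear_op_scale[OF assms, of 0 "\<lambda>_. 0"] in simp_all)

lemma row_finite_tridiag: "row_finite (tridiag \<delta> \<upsilon> l)"
  by (rule row_finiteI[of 1]) (simp add: tridiag_def)

lemma act_tridiag:
  "act (tridiag \<delta> \<upsilon> l) v i
    = (if i = 0 then 0 else l (i - 1) * v (i - 1)) + \<delta> i * v i + \<upsilon> i * v (Suc i)"
proof (cases i)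
  case 0
  then show ?thesis by (subst act_eq_sum[of "{0, 1}"]) (auto simp: tridiag_def)
next
  case (Suc k)
  then show ?thesis
    by (subst act_eq_sum[of "{k, Suc k, Suc (Suc k)}"]) (auto simp: tridiag_def algebra_simps)
qed

lemma row_finite_y_pencil:
  assumes "row_finite M" "row_finite K"
  shows "row_finite (y_pencil M K)"
  unfolding row_finite_def
proof
  fix i
  have "{j. y_pencil M K i j \<noteq> 0} \<subseteq> {j. M i j \<noteq> 0} \<union> {j. K i j \<noteq> 0}"
    by (auto simp: y_pencil_def)
  then show "finite {j. y_pencil M K i j \<noteq> 0}"
    by (rule finite_subset) (use assms in \<open>simp add: row_finite_def\<close>)
qed

lemma coeff_act_y_pencil:
  assumes "row_finite M" "row_finite K"
  shows "coeff (act (y_pencil M K) v i) m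
    = act M (\<lambda>j. coeff (v j) m) i + (if m = 0 then 0 else act K (\<lambda>j. coeff (v j) (m - 1)) i)"
proof -
  let ?A = "{j. M i j \<noteq> 0} \<union> {j. K i j \<noteq> 0}"
  have A: "finite ?A" using assms by (simp add: row_finite_def)
  have 1: "act M v i = (\<Sum>j\<in>?A. M i j * v j)" "act K v i = (\<Sum>j\<in>?A. K i j * v j)" for v
    by (rule act_eq_sum[OF A]; auto)+
  have 2: "act (y_pencil M K) v i = (\<Sum>j\<in>?A. y_pencil M K i j * v j)"
    by (rule act_eq_sum[OF A]) (auto simp: y_pencil_def)
  have 3: "coeff (y_pencil M K i j * w) m
      = M i j * coeff w m + (if m = 0 then 0 else K i j * coeff w (m - 1))" for j w
    by (simp add: y_pencil_def distrib_right monom_Suc coeff_pCons split: nat.split)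
  show ?thesis
    by (auto simp: 1 2 3 coeff_sum sum.distrib)
qed

subsection \<open>Rational identities for the matrix entries\<close>

text \<open>
  The arguments are \<open>s = a + c\<close>, \<open>p = ac\<close>, \<open>t = b + d\<close>, \<open>u = bd\<close> and \<open>y = q\<^sup>n\<^sup>-\<^sup>1\<close>; the entries of
  \<open>e\<close> arise from those of \<open>d\<close> by exchanging \<open>(s, p)\<close> with \<open>(t, u)\<close>.
\<close>

definition diag_entry :: "complex \<Rightarrow> complex \<Rightarrow> complex \<Rightarrow> complex \<Rightarrow> complex \<Rightarrow> complex \<Rightarrow> complex" where
  "diag_entry s p t u q y =
     y / ((1 - y^2 * (p*u)) * (1 - y^2 * q^2 * (p*u)))
     * (u*s + t*q - p*u*t*y - (u*s + p*u*t)*y*q - u*s*y*q^2 + u^2*p*s*y^2*q + p*u*t*y^2*q^2)"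

definition quartic :: "complex \<Rightarrow> complex \<Rightarrow> complex \<Rightarrow> complex \<Rightarrow> complex \<Rightarrow> complex" where
  "quartic s p t u x =
     1 - t*s*x + (t^2 - 2*u)*p*x^2 + u*s^2*x^2 - t*u*s*p*x^3 + u^2*p^2*x^4"

definition off_entry :: "complex \<Rightarrow> complex \<Rightarrow> complex \<Rightarrow> complex \<Rightarrow> complex \<Rightarrow> complex \<Rightarrow> complex" where
  "off_entry s p t u q y =
     (1 - y*(p*u)) * (1 - y*q^2) * quartic s p t u (y*q)
     / ((1 - y^2*q*(p*u)) * (1 - y^2*q^2*(p*u))^2 * (1 - y^2*q^3*(p*u)))"

lemma frac_sum_eqI:
  fixes D0 D1 D2 :: complex
  assumes "D0 \<noteq> 0" "D1 \<noteq> 0" "D2 \<noteq> 0"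
    and "- M * D2^2 + k * A * B * D1 + L * D0^2 = k * D0^2 * D1 * D2^2"
  shows "- M / (D0^2 * D1) + k * (A / (D0 * D2)) * (B / (D0 * D2)) + L / (D1 * D2^2) = k"
proof -
  have "- M / (D0^2 * D1) + k * (A / (D0 * D2)) * (B / (D0 * D2)) + L / (D1 * D2^2)
      = (- M * D2^2 + k * A * B * D1 + L * D0^2) / (D0^2 * D1 * D2^2)"
    using assms(1-3) by (simp add: field_simps power2_eq_square)
  then show ?thesis unfolding assms(4) using assms(1-3) by simp
qed

lemma diagonal_relation:
  fixes s p t u q y :: complex
  assumes "1 - y^2 * (p*u) \<noteq> 0" "1 - y^2 * q * (p*u) \<noteq> 0" "1 - y^2 * q^2 * (p*u) \<noteq> 0"
  shows "- ((q - y*(p*u)) * (1 - y*q) * quartic s p t u y) / ((1 - y^2*(p*u))^2 * (1 - y^2*q*(p*u)))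
     + (1 - q) * diag_entry s p t u q y * diag_entry t u s p q y
     + (1 - y*(p*u)) * (1 - y*q^2) * quartic s p t u (y*q) / ((1 - y^2*q*(p*u)) * (1 - y^2*q^2*(p*u))^2)
     = 1 - q"
proof -
  have *: "diag_entry t u s p q y = (y * (p*t + s*q - p*u*s*y - (p*t + p*u*s)*y*q - p*t*y*q^2 + p^2*u*t*y^2*q + p*u*s*y^2*q^2))
     / ((1 - y^2 * (p*u)) * (1 - y^2 * q^2 * (p*u)))"
    unfolding diag_entry_def by (simp add: mult_ac)
  have **: "diag_entry s p t u q y = (y * (u*s + t*q - p*u*t*y - (u*s + p*u*t)*y*q - u*s*y*q^2 + u^2*p*s*y^2*q + p*u*t*y^2*q^2))
     / ((1 - y^2 * (p*u)) * (1 - y^2 * q^2 * (p*u)))"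
    unfolding diag_entry_def by (simp add: mult_ac)
  show ?thesis unfolding * **
    by (rule frac_sum_eqI[OF assms], unfold quartic_def, algebra)
qed

lemma superdiagonal_relation:
  fixes s p t u q y :: complex
  assumes "1 - y^2 * (p*u) \<noteq> 0" "1 - y^2 * q^2 * (p*u) \<noteq> 0" "1 - y^2 * q^4 * (p*u) \<noteq> 0"
  shows "diag_entry t u s p q (y*q) - y*q*p * diag_entry s p t u q y
     = q * (diag_entry t u s p q y - y*q*p * diag_entry s p t u q (y*q))"
proof -
  have rule: "E' / (D1*D2) - x * (D / (D0*D1)) = q * (E / (D0*D1) - x * (D' / (D1*D2)))"
    if "D0 \<noteq> 0" "D1 \<noteq> 0" "D2 \<noteq> 0" "E' * D0 - x * D * D2 = q * (E * D2 - x * D' * D0)" for E' E D D' D0 D1 D2 x :: complex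
  proof -
    have "E' / (D1*D2) - x * (D / (D0*D1)) = (E' * D0 - x * D * D2) / (D0 * D1 * D2)"
      using that(1-3) by (simp add: field_simps)
    also have "\<dots> = q * (E / (D0*D1) - x * (D' / (D1*D2)))"
      unfolding that(4) using that(1-3) by (simp add: field_simps)
    finally show ?thesis .
  qed
  have 1: "diag_entry t u s p q z = (z * (p*t + s*q - p*u*s*z - (p*t + p*u*s)*z*q - p*t*z*q^2 + p^2*u*t*z^2*q + p*u*s*z^2*q^2))
     / ((1 - z^2 * (p*u)) * (1 - z^2 * q^2 * (p*u)))" for z
    unfolding diag_entry_def by (simp add: mult_ac)
  have 2: "diag_entry s p t u q z = (z * (u*s + t*q - p*u*t*z - (u*s + p*u*t)*z*q - u*s*z*q^2 + u^2*p*s*z^2*q + p*u*t*z^2*q^2))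
     / ((1 - z^2 * (p*u)) * (1 - z^2 * q^2 * (p*u)))" for z
    unfolding diag_entry_def by (simp add: mult_ac)
  have 3: "(y*q)^2 = y^2*q^2" "(y^2*q^2)*q^2 = y^2*q^4" by algebra+
  show ?thesis unfolding 1 2 3
    by (rule rule[OF assms], algebra)
qed

lemma diag_entry_partial_fractions:
  assumes "1 - y^2 * (p*u) \<noteq> 0" "1 - y^2 * q * (p*u) \<noteq> 0" "1 - y^2 * q^2 * (p*u) \<noteq> 0"
  shows "diag_entry s p t u q y
    = y*q*(1 - y*(p*u)) * (t - u*(y*q)*s) / ((1 - y^2*q*(p*u)) * (1 - y^2*q^2*(p*u)))
      - (1 - y*q)*u*y*(y*p*t - s) / ((1 - y^2*(p*u)) * (1 - y^2*q*(p*u)))"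
proof -
  have rule: "D / (D0*D2) = M / (D1*D2) - N / (D0*D1)"
    if "D0 \<noteq> 0" "D1 \<noteq> 0" "D2 \<noteq> 0" "D * D1 = M * D0 - N * D2" for D M N D0 D1 D2 :: complex
  proof -
    have "D / (D0*D2) = (D * D1) / (D0 * D1 * D2)" using that(1-3) by simp
    also have "\<dots> = M / (D1*D2) - N / (D0*D1)"
      unfolding that(4) using that(1-3) by (simp add: field_simps)
    finally show ?thesis .
  qed
  show ?thesis unfolding diag_entry_def times_divide_eq_left
    by (rule rule[OF assms], algebra)
qed

subsection \<open>Gaussian binomial coefficients\<close>

fun qbin :: "'a::comm_ring_1 \<Rightarrow> nat \<Rightarrow> nat \<Rightarrow> 'a" where
  "qbin q n 0 = 1"
| "qbin q 0 (Suc r) = 0"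
| "qbin q (Suc n) (Suc r) = q ^ Suc r * qbin q n (Suc r) + qbin q n r"

lemma qbin_eq_0: "n < r \<Longrightarrow> qbin q n r = 0"
  by (induction q n r rule: qbin.induct) auto

lemma qbin_self: "qbin q n n = 1"
  by (induction n) (simp_all add: qbin_eq_0)

text \<open>Stated without division because \<open>q\<close> may be a root of unity.\<close>

lemma qbin_absorb:
  "r \<le> n \<Longrightarrow> (1 - q ^ Suc r) * qbin q n (Suc r) = (1 - q ^ (n - r)) * qbin q n r"
proof (induction n arbitrary: r)
  case (Suc n)
  show ?case
  proof (cases "r \<le> n")
    case True
    have left: "(1 - q ^ Suc r) * qbin q (Suc n) (Suc r) = (1 - q ^ Suc n) * qbin q n r"
    proof -
      have "(1 - q ^ Suc r) * qbin q (Suc n) (Suc r)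
          = q ^ Suc r * ((1 - q ^ Suc r) * qbin q n (Suc r)) + (1 - q ^ Suc r) * qbin q n r"
        by (simp add: algebra_simps)
      also have "\<dots> = (1 - q ^ Suc r * q ^ (n - r)) * qbin q n r"
        unfolding Suc.IH[OF True] by (simp add: algebra_simps)
      also have "q ^ Suc r * q ^ (n - r) = q ^ Suc n"
        using True by (simp flip: power_add power_Suc)
      finally show ?thesis .
    qed
    show ?thesis
    proof (cases r)
      case 0
      with left show ?thesis by simp
    next
      case (Suc j)
      with True have j: "j \<le> n" "n - j = Suc n - r" by auto
      have "(1 - q ^ (Suc n - r)) * qbin q (Suc n) r
          = (1 - q ^ (Suc n - r)) * q ^ r * qbin q n r + (1 - q ^ (n - j)) * qbin q n j"
        using Suc j by (simp add: algebra_simps)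
      also have "\<dots> = (1 - q ^ (Suc n - r) * q ^ r) * qbin q n r"
        unfolding Suc.IH[OF j(1), symmetric] Suc by (simp add: algebra_simps)
      also have "\<dots> = (1 - q ^ Suc n) * qbin q n r"
        using True by (simp flip: power_add power_Suc)
      finally show ?thesis using left by simp
    qed
  next
    case False
    with Suc.prems have "r = Suc n" by simp
    then show ?thesis by (simp add: qbin_eq_0)
  qed
qed simp

lemma binomial_sum_Suc:
  fixes f :: "nat \<Rightarrow> 'a::comm_ring_1"
  shows "(\<Sum>n\<le>Suc N. of_nat (Suc N choose n) * f n)
    = (\<Sum>n\<le>N. of_nat (N choose n) * f n) + (\<Sum>n\<le>N. of_nat (N choose n) * f (Suc n))"
proof -
  have "(\<Sum>n\<le>Suc N. of_nat (Suc N choose n) * f n)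
      = f 0 + (\<Sum>n\<le>N. of_nat (N choose Suc n) * f (Suc n)) + (\<Sum>n\<le>N. of_nat (N choose n) * f (Suc n))"
    by (subst sum.atMost_Suc_shift) (simp add: sum.distrib algebra_simps)
  also have "f 0 + (\<Sum>n\<le>N. of_nat (N choose Suc n) * f (Suc n)) = (\<Sum>n\<le>Suc N. of_nat (N choose n) * f n)"
    by (subst sum.atMost_Suc_shift) simp
  also have "\<dots> = (\<Sum>n\<le>N. of_nat (N choose n) * f n)"
    by (simp add: binomial_eq_0)
  finally show ?thesis .
qed

subsection \<open>The quadratic algebra with boundary vectors\<close>

locale q_oscillator =
  fixes dd ee :: "complex ivec \<Rightarrow> complex ivec" and q s p t u :: complex
  assumes linear_d: "linear_op dd" and linear_e: "linear_op ee"
    and commutation: "dd (ee v) = (\<lambda>i. q * ee (dd v) i + (1 - q) * v i)"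
    and left_boundary: "ee v 0 = s * v 0 - p * dd v 0"
    and right_boundary: "dd (vec_V 0) = (\<lambda>i. t * vec_V 0 i - u * ee (vec_V 0) i)"
begin

definition B :: "complex ivec \<Rightarrow> complex ivec" where
  "B v = (\<lambda>i. v i - ee (dd v) i)"

lemma linear_B: "linear_op B"
  unfolding linear_op_def B_def
  by (simp add: linear_op_combination[OF linear_d] linear_op_combination[OF linear_e] algebra_simps)

lemmas linear_B_pow = linear_op_funpow[OF linear_B]

lemma d_B: "dd (B v) = (\<lambda>i. q * B (dd v) i)"
  by (simp add: B_def linear_op_diff[OF linear_d] commutation algebra_simps)

lemma B_e: "B (ee v) = (\<lambda>i. q * ee (B v) i)"
  unfolding B_def commutation linear_op_diff[OF linear_e] linear_op_combination[OF linear_e]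
  by (simp add: algebra_simps)

lemma d_B_pow: "dd ((B ^^ r) v) = (\<lambda>i. q ^ r * (B ^^ r) (dd v) i)"
  by (induction r) (simp_all add: d_B linear_op_scale[OF linear_B] mult_ac)

lemma B_pow_e: "(B ^^ r) (ee v) = (\<lambda>i. q ^ r * ee ((B ^^ r) v) i)"
  by (induction r) (simp_all add: B_e linear_op_scale[OF linear_B] mult_ac)

lemma d_pow_e:
  "(dd ^^ k) (ee v) = (\<lambda>i. q ^ k * ee ((dd ^^ k) v) i + (1 - q ^ k) * (dd ^^ (k - 1)) v i)"
proof (induction k)
  case (Suc k)
  have "dd ((dd ^^ (k - 1)) v) i = (dd ^^ k) v i \<or> 1 - q ^ k = 0" for i
    by (cases k) auto
  then have *: "(1 - q ^ k) * dd ((dd ^^ (k - 1)) v) i = (1 - q ^ k) * (dd ^^ k) v i" for i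
    by auto
  show ?case
    unfolding funpow.simps o_apply Suc.IH linear_op_combination[OF linear_d] commutation * diff_Suc_1
    by (simp add: algebra_simps)
qed simp

definition f :: "nat \<Rightarrow> nat \<Rightarrow> complex" where
  "f r k = (B ^^ r) ((dd ^^ k) (vec_V 0)) 0"

lemma B_pow_e_at_0: "(B ^^ r) (ee v) 0 = q ^ r * (s * (B ^^ r) v 0 - p * q ^ r * (B ^^ r) (dd v) 0)"
  by (simp add: B_pow_e left_boundary d_B_pow mult_ac)

lemma f_three_term:
  "(1 - u * (p * q ^ (2*r)) * q ^ k) * f r (Suc k)
    = (t - u * (s * q ^ r) * q ^ k) * f r k - u * (1 - q ^ k) * f r (k - 1)"
proof -
  have "f r (Suc k) = t * f r k - u * (B ^^ r) ((dd ^^ k) (ee (vec_V 0))) 0"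
    unfolding f_def funpow_Suc_right o_apply right_boundary
    using linear_op_combination[OF linear_op_funpow[OF linear_d], of k t "vec_V 0" "-u" "ee (vec_V 0)"]
      linear_op_combination[OF linear_B_pow, of r t _ "-u"]
    by simp
  also have "(B ^^ r) ((dd ^^ k) (ee (vec_V 0))) 0
      = q ^ k * (q ^ r * (s * f r k - p * q ^ r * f r (Suc k))) + (1 - q ^ k) * f r (k - 1)"
    by (simp add: d_pow_e linear_op_combination[OF linear_B_pow] B_pow_e_at_0 f_def)
  finally show ?thesis by (simp add: algebra_simps power_mult power2_eq_square power_mult_distrib)
qed

lemma f_Suc:
  "f (Suc r) k = f r k - s * q ^ r * f r (Suc k) + p * q ^ (2*r) * f r (Suc (Suc k))"
proof -
  have "f (Suc r) k = (B ^^ r) (B ((dd ^^ k) (vec_V 0))) 0"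
    by (simp add: f_def funpow_swap1)
  also have "\<dots> = f r k - (B ^^ r) (ee ((dd ^^ Suc k) (vec_V 0))) 0"
    by (subst B_def) (simp add: linear_op_diff[OF linear_B_pow] f_def)
  finally show ?thesis
    by (simp add: B_pow_e_at_0 f_def algebra_simps power_mult power2_eq_square power_mult_distrib)
qed

lemma f_0_0: "f 0 0 = 1"
  by (simp add: f_def vec_V_def)

lemma f_lower:
  "u * (1 - q ^ k) * f (Suc r) (k - 1)
    = (t - u * (s * q ^ r)) * f r k - (1 - u * (p * q ^ (2*r))) * f r (Suc k)"
proof (cases k)
  case 0
  then show ?thesis using f_three_term[of r 0] by simp
next
  case (Suc j)
  have "u * (1 - K) * (F0 - S * F1 + P * F2) = (t - u * S) * F1 - (1 - u * P) * F2"
    if "(1 - u * P * K) * F2 = (t - u * S * K) * F1 - u * (1 - K) * F0" for F0 F1 F2 S P K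
    using that by algebra
  from this[OF f_three_term[of r "Suc j", unfolded diff_Suc_1]] show ?thesis
    unfolding Suc f_Suc diff_Suc_1 .
qed

lemma f_raise:
  "(1 - u * (p * q ^ (2*r)) * q ^ Suc k) * f (Suc r) k
    = (1 - u * (p * q ^ (2*r))) * f r k + (p * q ^ (2*r) * t - s * q ^ r) * f r (Suc k)"
proof -
  have "(1 - u * P * K) * G = (1 - u * P) * F0 + (P * t - S) * F1"
    if "u * (1 - K) * G = (t - u * S) * F1 - (1 - u * P) * F2" "G = F0 - S * F1 + P * F2"
    for F0 F1 F2 G S P K
    using that by algebra
  from this[OF f_lower[of "Suc k" r, unfolded diff_Suc_1] f_Suc] show ?thesis .
qed

lemma f_Suc_0:
  "(1 - u * (p * q ^ (2*r))) * (1 - u * (p * q ^ (2*r)) * q) * f (Suc r) 0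
    = quartic s p t u (q ^ r) * f r 0"
proof -
  have "(1 - u * (p * x^2)) * (1 - u * (p * x^2) * q) * G = quartic s p t u x * F0"
    if "(1 - u * (p * x^2) * q) * G = (1 - u * (p * x^2)) * F0 + (p * x^2 * t - s * x) * F1"
      "(1 - u * (p * x^2)) * F1 = (t - u * (s * x)) * F0" for F0 F1 G x
    using that unfolding quartic_def by algebra
  from this[of "q ^ r"] show ?thesis
    using f_raise[of r 0] f_three_term[of r 0] by (simp add: power_mult mult.commute[of 2 r])
qed

definition pencil_coeff :: "nat \<Rightarrow> nat \<Rightarrow> complex ivec" where
  "pencil_coeff n m = (\<lambda>i. qbin q n m * (B ^^ m) ((dd ^^ (n - m)) (vec_V 0)) i)"

lemma pencil_coeff_0: "pencil_coeff 0 m i = (if m = 0 then vec_V 0 i else 0)"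
  by (cases m) (simp_all add: pencil_coeff_def)

lemma pencil_coeff_Suc: "pencil_coeff (Suc n) m i = dd (pencil_coeff n m) i + (if m = 0 then 0 else B (pencil_coeff n (m - 1)) i)"
proof (cases m)
  case 0
  then show ?thesis by (simp add: pencil_coeff_def)
next
  case (Suc j)
  have *: "qbin q n (Suc j) * dd ((B ^^ Suc j) ((dd ^^ (n - Suc j)) (vec_V 0))) i
      = q ^ Suc j * qbin q n (Suc j) * (B ^^ Suc j) ((dd ^^ (n - j)) (vec_V 0)) i"
  proof (cases "Suc j \<le> n")
    case True
    then have "n - j = Suc (n - Suc j)" by simp
    then have "(dd ^^ (n - j)) (vec_V 0) = dd ((dd ^^ (n - Suc j)) (vec_V 0))" by simp
    then show ?thesis by (simp only: d_B_pow mult_ac)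
  qed (simp add: qbin_eq_0)
  show ?thesis
    unfolding Suc pencil_coeff_def linear_op_scale[OF linear_d] linear_op_scale[OF linear_B]
    by (simp add: * del: funpow.simps power_Suc) (simp add: algebra_simps)
qed

end

subsection \<open>The tridiagonal representation\<close>

lemma act_tridiag_commutation:
  fixes q p u :: complex and \<delta> \<epsilon> \<xi> :: "nat \<Rightarrow> complex"
  assumes diag0: "(1 - q) * \<delta> 0 * \<epsilon> 0 + \<xi> 0 * (1 - q * (p*u)) = 1 - q"
    and diag: "\<And>n. \<xi> n * (q ^ n * q ^ n * (p*u) - q) + (1 - q) * \<delta> (Suc n) * \<epsilon> (Suc n)
      + \<xi> (Suc n) * (1 - q ^ n * q ^ n * q ^ 3 * (p*u)) = 1 - q"
    and super: "\<And>n. \<epsilon> (Suc n) - q ^ n * p * \<delta> n = q * (\<epsilon> n - q ^ n * p * \<delta> (Suc n))"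
    and sub: "\<And>n. \<delta> (Suc n) - q ^ n * u * \<epsilon> n = q * (\<delta> n - q ^ n * u * \<epsilon> (Suc n))"
  defines "dm \<equiv> tridiag \<delta> (\<lambda>_. 1) (\<lambda>n. - (q ^ n * u * \<xi> n))"
    and "em \<equiv> tridiag \<epsilon> (\<lambda>n. - (q ^ n * p)) \<xi>"
  shows "act dm (act em v) = (\<lambda>i. q * act em (act dm v) i + (1 - q) * v i)"
proof
  fix i
  show "act dm (act em v) i = q * act em (act dm v) i + (1 - q) * v i"
  proof (cases i)
    case 0
    have "D0 * (E0 * v0 + - p * v1) + (X * v0 + E1 * v1 + - (q * p) * v2)
        = q * (E0 * (D0 * v0 + v1) + - p * (- (u * X) * v0 + D1 * v1 + v2)) + (1 - q) * v0"
      if "(1 - q) * D0 * E0 + X * (1 - q * (p*u)) = 1 - q" "E1 - p * D0 = q * (E0 - p * D1)"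
      for D0 E0 X D1 E1 v0 v1 v2 :: complex
      using that by algebra
    from this[OF diag0, OF super[of 0, simplified]] show ?thesis
      unfolding 0 dm_def em_def act_tridiag by simp
  next
    case (Suc j)
    define L where "L = (if j = 0 then 0 else \<xi> (j - 1) * v (j - 1))"
    define L' where "L' = (if j = 0 then 0 else - (q ^ (j - 1) * u * \<xi> (j - 1)) * v (j - 1))"
    have L: "q ^ j * u * L = - q * L'"
      unfolding L_def L'_def by (cases j) auto
    have at_j: "act em v j = L + \<epsilon> j * v j + - (q ^ j * p) * v (Suc j)"
      "act dm v j = L' + \<delta> j * v j + v (Suc j)"
      unfolding em_def dm_def act_tridiag L_def L'_def by simp_all
    have at_Suc: "act em w (Suc n) = \<xi> n * w n + \<epsilon> (Suc n) * w (Suc n) + - (q * q ^ n * p) * w (Suc (Suc n))"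
      "act dm w (Suc n) = - (q ^ n * u * \<xi> n) * w n + \<delta> (Suc n) * w (Suc n) + w (Suc (Suc n))" for w n
      unfolding em_def dm_def act_tridiag by simp_all
    have "- (x * u * X0) * (L + E0 * v0 + - (x * p) * v1)
          + D1 * (X0 * v0 + E1 * v1 + - (q * x * p) * v2)
          + (X1 * v1 + E2 * v2 + - (q * (q * x) * p) * v3)
        = q * (X0 * (L' + D0 * v0 + v1)
          + E1 * (- (x * u * X0) * v0 + D1 * v1 + v2)
          + - (q * x * p) * (- (q * x * u * X1) * v1 + D2 * v2 + v3)) + (1 - q) * v1"
      if "X0 * (x * x * (p*u) - q) + (1 - q) * D1 * E1 + X1 * (1 - x * x * q ^ 3 * (p*u)) = 1 - q"
        "E2 - q * x * p * D1 = q * (E1 - q * x * p * D2)"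
        "D1 - x * u * E0 = q * (D0 - x * u * E1)"
        "x * u * L = - q * L'"
      for D0 D1 D2 E0 E1 E2 X0 X1 v0 v1 v2 v3 x L L' :: complex
      using that by algebra
    from this[OF diag, OF super[of "Suc j", unfolded power_Suc] sub L, of "v j" "v (Suc j)" "v (Suc (Suc j))" "v (Suc (Suc (Suc j)))"]
    show ?thesis
      unfolding Suc at_Suc at_j power_Suc .
  qed
qed

lemma quartic_factorization:
  "quartic (a + c) (a*c) (b + d) (b*d) x
    = (1 - x*(a*b)) * (1 - x*(a*d)) * (1 - x*(b*c)) * (1 - x*(c*d))"
  unfolding quartic_def by algebra

locale askey_wilson_generic =
  fixes a b c d q :: complex
  assumes generic_params: "generic_params a b c d q"
begin

abbreviation "s \<equiv> a + c"
abbreviation "p \<equiv> a * c"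
abbreviation "t \<equiv> b + d"
abbreviation "u \<equiv> b * d"
abbreviation "dop \<equiv> act (d_mat a b c d q)"
abbreviation "eop \<equiv> act (e_mat a b c d q)"

definition y :: "nat \<Rightarrow> complex" where
  "y n = q powi (int n - 1)"

lemma q_nonzero: "q \<noteq> 0" and q_neq_1: "q \<noteq> 1" and quartic_nonzero: "quartic s p t u (q ^ n) \<noteq> 0"
  using generic_params by (auto simp: generic_params_def quartic_factorization)

lemma y_times_q: "y n * q = q ^ n"
  using q_nonzero power_int_minus_mult[of q "int n"] by (simp add: y_def)

lemma y_Suc: "y (Suc n) = q ^ n"
  by (simp add: y_def)

lemma y_squared: "(y n)^2 * q ^ j = q powi (2 * int n - 2 + int j)"
proof -
  have "2 * int n - 2 + int j = (int n - 1) + (int n - 1) + int j" by simp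
  then show ?thesis
    using q_nonzero by (simp only: power_int_add y_def power2_eq_square power_int_of_nat simp_thms)
qed

lemma denominator_nonzero: "1 - (y n)^2 * q ^ j * (p*u) \<noteq> 0"
proof -
  have "1 - q powi (2 * int n - 2 + int j) * (a*b*c*d) \<noteq> 0"
    using generic_params unfolding generic_params_def by simp
  then show ?thesis unfolding y_squared by (simp add: mult_ac)
qed

lemmas denominators_nonzero =
  denominator_nonzero[of _ 0, unfolded power_0 mult_1_right]
  denominator_nonzero[of _ 1, unfolded power_one_right]
  denominator_nonzero[of _ 2] denominator_nonzero[of _ 3] denominator_nonzero[of _ 4]

lemma power_conversions:
  "q powi (int n - 1) = y n" "q ^ n = y n * q" "q ^ (n + 1) = y n * q^2" "q powi (2 * int n - 2) = (y n)^2"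
  "q powi (2 * int n - 1) = (y n)^2 * q" "q ^ (2*n) = (y n)^2 * q^2"
  "q ^ (2*n + 1) = (y n)^2 * q^3"
proof -
  show "q powi (int n - 1) = y n" by (simp add: y_def)
  show 1: "q ^ n = y n * q" by (simp add: y_times_q)
  then show "q ^ (n + 1) = y n * q^2" by (simp add: power2_eq_square)
  show "q powi (2 * int n - 2) = (y n)^2" "q powi (2 * int n - 1) = (y n)^2 * q"
    using y_squared[of n 0] y_squared[of n 1] by simp_all
  have "q ^ (2*n) = (q ^ n)^2" by (simp add: power_mult mult.commute)
  then show 2: "q ^ (2*n) = (y n)^2 * q^2" by (simp only: 1 power_mult_distrib)
  then show "q ^ (2*n + 1) = (y n)^2 * q^3" by (simp add: power2_eq_square power3_eq_cube)
qed

lemma d_nat_eq: "d_nat a b c d q n = diag_entry s p t u q (y n)"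
  unfolding d_nat_def power_conversions[of n] diag_entry_def
  by (simp add: mult_ac power2_eq_square)

lemma e_nat_eq: "e_nat a b c d q n = diag_entry t u s p q (y n)"
  unfolding e_nat_def power_conversions[of n] diag_entry_def
  by (simp add: mult_ac power2_eq_square)

lemma e_flat_eq: "e_flat a b c d q n = off_entry s p t u q (y n)"
proof -
  have nz: "1 - q ^ n * (a*c) \<noteq> 0" "1 - q ^ n * (b*d) \<noteq> 0"
    using generic_params by (auto simp: generic_params_def)
  have w: "a*b*c*d = p*u" by (simp add: mult_ac)
  have "e_flat a b c d q n = (1 - y n * (p*u)) * (1 - q ^ (n + 1)) *
      ((1 - q ^ n*(a*b)) * (1 - q ^ n*(a*d)) * (1 - q ^ n*(b*c)) * (1 - q ^ n*(c*d)))
     / ((1 - q powi (2 * int n - 1) * (p*u)) * (1 - q ^ (2*n) * (p*u)) ^ 2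
       * (1 - q ^ (2*n + 1) * (p*u)))"
    using nz unfolding e_flat_def cal_A_def w y_def by (simp add: mult_ac)
  then show ?thesis
    unfolding off_entry_def quartic_factorization[symmetric] power_conversions[of n] .
qed

lemma d_flat_eq: "d_flat a b c d q n = - (q ^ n * u * off_entry s p t u q (y n))"
  unfolding e_flat_eq[symmetric] d_flat_def e_flat_def by (simp add: mult_ac)

lemma d_mat_eq: "d_mat a b c d q = tridiag (\<lambda>n. diag_entry s p t u q (y n)) (\<lambda>_. 1)
    (\<lambda>n. - (q ^ n * u * off_entry s p t u q (y n)))"
  unfolding d_mat_def d_flat_eq[abs_def] d_nat_eq[abs_def] ..

lemma e_mat_eq: "e_mat a b c d q = tridiag (\<lambda>n. diag_entry t u s p q (y n)) (\<lambda>n. - (q ^ n * p))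
    (\<lambda>n. off_entry s p t u q (y n))"
  unfolding e_mat_def e_flat_eq[abs_def] e_nat_eq[abs_def] by (simp add: mult_ac)

lemma off_entry_cancel_upper:
  "off_entry s p t u q (y n) * (1 - (y n)^2 * q^3 * (p*u))
    = (1 - y n * (p*u)) * (1 - y n * q^2) * quartic s p t u (y n * q)
      / ((1 - (y n)^2*q*(p*u)) * (1 - (y n)^2*q^2*(p*u))^2)"
  unfolding off_entry_def using denominators_nonzero(4)[of n] by simp

lemma off_entry_cancel_lower:
  "off_entry s p t u q (y n) * ((y n * q)^2 * (p*u) - q)
    = - ((q - (y n * q)*(p*u)) * (1 - (y n * q)*q) * quartic s p t u (y n * q))
      / ((1 - (y n * q)^2*(p*u))^2 * (1 - (y n * q)^2*q*(p*u)))"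
proof -
  have rule: "M / (D1 * D2 * D3) * (- q * D1) = - (q * M) / (D2 * D3)" if "D1 \<noteq> 0" for M D1 D2 D3 :: complex
    using that by simp
  have *: "(y n * q)^2 * (p*u) - q = - q * (1 - (y n)^2 * q * (p*u))"
    "q - (y n * q)*(p*u) = q * (1 - y n * (p*u))" "(y n * q)*q = y n * q^2"
    "(y n * q)^2 = (y n)^2 * q^2" "(y n)^2 * q^2 * q = (y n)^2 * q^3"
    by algebra+
  show ?thesis
    unfolding *(1) off_entry_def rule[OF denominators_nonzero(2)] unfolding *(2-) by (simp add: mult_ac)
qed

sublocale q_oscillator dop eop q s p t u
proof
  show "linear_op dop" "linear_op eop"
    unfolding d_mat_eq e_mat_eq by (intro linear_op_act row_finite_tridiag)+
  have y0: "y 0 * q = 1" by (simp add: y_times_q)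
  let ?\<delta> = "\<lambda>n. diag_entry s p t u q (y n)" and ?\<epsilon> = "\<lambda>n. diag_entry t u s p q (y n)"
    and ?\<xi> = "\<lambda>n. off_entry s p t u q (y n)"
  have rel: "- ((q - y n*(p*u)) * (1 - y n*q) * quartic s p t u (y n)) / ((1 - (y n)^2*(p*u))^2 * (1 - (y n)^2*q*(p*u)))
     + (1 - q) * ?\<delta> n * ?\<epsilon> n + ?\<xi> n * (1 - (y n)^2 * q^3 * (p*u)) = 1 - q" for n
    unfolding off_entry_cancel_upper
    by (rule diagonal_relation[OF denominators_nonzero(1-3)])
  have diag0: "(1 - q) * ?\<delta> 0 * ?\<epsilon> 0 + ?\<xi> 0 * (1 - q * (p*u)) = 1 - q"
  proof -
    have "(y 0)^2 * q^3 = q" using y0 by algebra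
    then show ?thesis using rel[of 0] y0 by simp
  qed
  have diag: "?\<xi> n * (q ^ n * q ^ n * (p*u) - q) + (1 - q) * ?\<delta> (Suc n) * ?\<epsilon> (Suc n)
      + ?\<xi> (Suc n) * (1 - q ^ n * q ^ n * q ^ 3 * (p*u)) = 1 - q" for n
    using rel[of "Suc n"] off_entry_cancel_lower[of n]
    unfolding y_times_q y_Suc power2_eq_square by simp
  have super: "?\<epsilon> (Suc n) - q ^ n * p * ?\<delta> n = q * (?\<epsilon> n - q ^ n * p * ?\<delta> (Suc n))" for n
    using superdiagonal_relation[OF denominators_nonzero(1,3,5)[of n], of t s]
    unfolding y_times_q y_Suc by simp
  have sub: "?\<delta> (Suc n) - q ^ n * u * ?\<epsilon> n = q * (?\<delta> n - q ^ n * u * ?\<epsilon> (Suc n))" for n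
    using superdiagonal_relation[of "y n" u p q s t] denominators_nonzero(1,3,5)[of n]
    unfolding y_times_q y_Suc by (simp add: mult.commute[of u p])
  show "dop (eop v) = (\<lambda>i. q * eop (dop v) i + (1 - q) * v i)" for v
    unfolding d_mat_eq e_mat_eq
    by (rule act_tridiag_commutation) (fact diag0 diag super sub)+
  have at_0: "?\<delta> 0 = (t - u * s) / (1 - p*u)" "?\<epsilon> 0 = (s - p * t) / (1 - p*u)"
    and nz: "1 - p*u \<noteq> 0"
  proof -
    have sq: "(y 0)^2 * q = y 0" "(y 0)^2 * q^2 = 1" using y0 by algebra+
    show "1 - p*u \<noteq> 0" using denominators_nonzero(3)[of 0] unfolding sq by simp
    have at_0: "diag_entry s' p' t' u' q (y 0) = (t' - u' * s') / (1 - p'*u')"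
      if "1 - (y 0)^2*(p'*u') \<noteq> 0" "1 - (y 0)^2*q*(p'*u') \<noteq> 0" "1 - (y 0)^2*q^2*(p'*u') \<noteq> 0"
      for s' p' t' u'
      using diag_entry_partial_fractions[OF that] that unfolding sq y0 by simp
    show "?\<delta> 0 = (t - u * s) / (1 - p*u)"
      by (rule at_0[OF denominators_nonzero(1-3)])
    show "?\<epsilon> 0 = (s - p * t) / (1 - p*u)"
      using at_0[of u p t s] denominators_nonzero(1-3)[of 0] unfolding mult.commute[of u p] by simp
  qed
  have "?\<epsilon> 0 = s - p * ?\<delta> 0" "?\<delta> 0 = t - u * ?\<epsilon> 0"
    unfolding at_0 using nz by (simp_all add: divide_simps) (simp_all add: algebra_simps)
  note boundary = this
  show "eop v 0 = s * v 0 - p * dop v 0" for v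
    unfolding d_mat_eq e_mat_eq act_tridiag boundary(1) by (simp add: algebra_simps)
  show "dop (vec_V 0) = (\<lambda>i. t * vec_V 0 i - u * eop (vec_V 0) i)"
  proof
    fix i
    show "dop (vec_V 0) i = t * vec_V 0 i - u * eop (vec_V 0) i"
      unfolding d_mat_eq e_mat_eq act_tridiag vec_V_def
      using boundary(2) by (cases "i = 0"; cases "i = 1") (auto simp: mult_ac)
  qed
qed

lemma q_power_double: "q ^ (2*r) = q ^ r * q ^ r"
  by (simp add: mult_2 power_add)

lemma level_denominators_nonzero:
  "1 - u * (p * q ^ (2*r)) \<noteq> 0" "1 - u * (p * q ^ (2*r)) * q \<noteq> 0"
  using denominators_nonzero(1,2)[of "Suc r"]
  unfolding y_Suc q_power_double power2_eq_square by (simp_all add: mult_ac)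

lemma f_r_0_nonzero: "f r 0 \<noteq> 0"
proof (induction r)
  case (Suc r)
  then show ?case
    using f_Suc_0[of r] quartic_nonzero[of r] by auto
qed (simp add: f_0_0)

definition g :: "nat \<Rightarrow> nat \<Rightarrow> complex" where
  "g r k = f r k / f r 0"

definition h :: "nat \<Rightarrow> complex" where
  "h r = f (Suc r) 0 / f r 0"

lemma h_times_g: "h r * g (Suc r) k = f (Suc r) k / f r 0"
  using f_r_0_nonzero by (simp add: g_def h_def)

lemma h_nonzero: "h r \<noteq> 0"
  using f_r_0_nonzero by (simp add: h_def)

lemma h_eq:
  "h r * ((1 - u * (p * q ^ (2*r))) * (1 - u * (p * q ^ (2*r)) * q)) = quartic s p t u (q ^ r)"
  using f_Suc_0[of r] f_r_0_nonzero[of r] by (simp add: h_def field_simps)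

lemma g_lower:
  "u * (1 - q ^ k) * (h r * g (Suc r) (k - 1))
    = (t - u * (s * q ^ r)) * g r k - (1 - u * (p * q ^ (2*r))) * g r (Suc k)"
  unfolding h_times_g unfolding g_def
  using f_lower[of k r] by (simp add: diff_divide_distrib[symmetric] times_divide_eq_right)

lemma g_raise:
  "(1 - u * (p * q ^ (2*r)) * q ^ Suc k) * (h r * g (Suc r) k)
    = (1 - u * (p * q ^ (2*r))) * g r k + (p * q ^ (2*r) * t - s * q ^ r) * g r (Suc k)"
  unfolding h_times_g unfolding g_def
  using f_raise[of r k] by (simp add: add_divide_distrib[symmetric] times_divide_eq_right)

text \<open>
  If \<open>q\<close> is a root of unity, the ratio of the two Gaussian binomials in the recurrence for
  \<open>\<langle>W|d\<^sup>n|V\<^sup>r\<rangle>\<close> cannot be formed. Their coefficients are therefore exhibited as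
  \<open>(1 - q\<^sup>r) Z\<close> and \<open>(1 - q\<^sup>k\<^sup>+\<^sup>1) Z\<close> with a common factor \<open>Z\<close>, which reduces the recurrence to
  \<open>qbin_absorb\<close>.
\<close>

definition Z :: "nat \<Rightarrow> nat \<Rightarrow> complex" where
  "Z r k = ((y r)^2 * q * (p*u) * g r (Suc k)
      + u * y r * (y r * p * t - s) / (1 - (y r)^2 * (p*u)) * g r k) / (1 - (y r)^2 * q * (p*u))"

lemma g_same_level:
  "q ^ r * g r (Suc k) - diag_entry s p t u q (y r) * g r k
     + q ^ r * u * ((1 - y r * (p*u)) * h r / ((1 - (y r)^2*q*(p*u)) * (1 - (y r)^2*q^2*(p*u))))
       * (1 - q ^ k) * g (Suc r) (k - 1)
    = (1 - q ^ r) * Z r k"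
proof -
  have calc: "x * G1 - (x*M*T/(D1*D2) - (1-x)*N/(D0*D1)) * G0 + x*u*(M*h/(D1*D2))*K*G'
      = (1-x) * ((x*yw*G1 + N/D0*G0)/D1)"
    if "D0 \<noteq> 0" "D1 \<noteq> 0" "D2 \<noteq> 0" "u*K*(h*G') = T*G0 - D2*G1" "D1 - M = yw*(1-x)"
    for x M T D0 D1 D2 N G0 G1 K G' h yw
  proof -
    have "x*u*(M*h/(D1*D2))*K*G' = x*M/(D1*D2)*(u*K*(h*G'))" by simp
    also have "\<dots> = x*M*T/(D1*D2)*G0 - x*M/D1*G1"
      unfolding that(4) using that(2,3) by (simp add: field_simps)
    finally have *: "x*u*(M*h/(D1*D2))*K*G' = x*M*T/(D1*D2)*G0 - x*M/D1*G1" .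
    have "x * G1 - (x*M*T/(D1*D2) - (1-x)*N/(D0*D1)) * G0 + x*u*(M*h/(D1*D2))*K*G'
        = (x - x*M/D1)*G1 + (1-x)*N/(D0*D1)*G0"
      unfolding * by algebra
    also have "x - x*M/D1 = x*(D1 - M)/D1" using that(2) by (simp add: field_simps)
    also have "x*(D1 - M)/D1*G1 + (1-x)*N/(D0*D1)*G0 = (1-x) * ((x*yw*G1 + N/D0*G0)/D1)"
      unfolding that(5) using that(1,2) by (simp add: field_simps)
    finally show ?thesis .
  qed
  have sq: "q ^ (2*r) = (y r)^2*q^2" by (rule power_conversions)
  have x: "q ^ r = y r * q" by (rule power_conversions)
  have 1: "u * (1 - q ^ k) * (h r * g (Suc r) (k - 1))
      = (t - u*(y r*q)*s) * g r k - (1 - (y r)^2*q^2*(p*u)) * g r (Suc k)"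
    using g_lower[of k r] unfolding sq x by (simp add: mult_ac)
  have 2: "(1 - (y r)^2*q*(p*u)) - (1 - y r*(p*u)) = y r * (p*u) * (1 - y r*q)"
    by algebra
  have 3: "y r * q * (y r * (p*u)) = (y r)^2 * q * (p*u)" by algebra
  from calc[OF denominators_nonzero(1-3) 1 2, of "u * y r * (y r * p * t - s)"]
  show ?thesis
    unfolding x Z_def diag_entry_partial_fractions[OF denominators_nonzero(1-3)] 3
    by (simp add: mult.assoc)
qed

lemma g_level_difference:
  "g r (Suc k) - g (Suc r) (Suc k) = (1 - q ^ Suc k) * Z (Suc r) k"
proof -
  have calc: "g1 - G1 = (1 - K) * ((x^2*q*(p*u)*G1 + u*x*(x*p*t - s)/D0*G0)/D1)"
    if D: "D0 \<noteq> 0" "D1 \<noteq> 0" "D0 = 1 - u*(p*x^2)" "D1 = 1 - u*(p*x^2)*q" and h: "h \<noteq> 0" "h*(D0*D1) = quartic s p t u x"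
      and raise: "(1 - u*(p*x^2)*(q*K))*(h*G1) = D0*g1 + (p*x^2*t - s*x)*g2"
      and lower: "u*(1 - K)*(h*G0) = (t - u*(s*x))*g1 - D0*g2"
    for g1 g2 G0 G1 K x D0 D1 h
  proof -
    have "h*(D0*D1)*(g1 - G1) = (1 - K)*h*(D0*x^2*q*(p*u)*G1 + u*x*(x*p*t - s)*G0)"
    proof -
      have "h*(D0*D1)*(g1 - G1) - (1 - K)*h*(D0*x^2*q*(p*u)*G1 + u*x*(x*p*t - s)*G0)
          = h*(D0*D1)*g1 - D0*((1 - u*(p*x^2)*(q*K))*(h*G1)) - (p*x^2*t - s*x)*(u*(1 - K)*(h*G0))"
        unfolding D(3,4) by algebra
      also have "\<dots> = 0"
        unfolding raise lower h(2) unfolding D(3) quartic_def by algebra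
      finally show ?thesis by simp
    qed
    also have "\<dots> = h*(D0*D1)*((1 - K) * ((x^2*q*(p*u)*G1 + u*x*(x*p*t - s)/D0*G0)/D1))"
      using D(1,2) by (simp add: field_simps)
    finally show ?thesis using D(1,2) h(1) by (simp only: mult_cancel_left mult_eq_0_iff simp_thms)
  qed
  have sq: "q ^ (2*r) = (q ^ r)^2" by (simp add: q_power_double power2_eq_square)
  have den: "1 - (q ^ r)^2 * (p*u) = 1 - u*(p*(q ^ r)^2)"
    "1 - (q ^ r)^2 * q * (p*u) = 1 - u*(p*(q ^ r)^2)*q"
    by algebra+
  show ?thesis
    unfolding Z_def y_Suc den
    by (rule calc[OF level_denominators_nonzero[of r, unfolded sq] refl refl h_nonzero
          h_eq[of r, unfolded sq] g_raise[of r "Suc k", unfolded sq power_Suc[of q "Suc k"]]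
          g_lower[of "Suc k" r, unfolded sq diff_Suc_1]])
qed

lemma off_entry_eq_h:
  "off_entry s p t u q (y r) = (1 - q ^ Suc r)
    * ((1 - y r * (p*u)) * h r / ((1 - (y r)^2*q*(p*u)) * (1 - (y r)^2*q^2*(p*u))))"
proof -
  have rule: "M * J * (h * (D2 * D3)) / (D1 * D2^2 * D3) = J * (M * h / (D1 * D2))"
    if "D2 \<noteq> 0" "D3 \<noteq> 0" for M J h D1 D2 D3 :: complex
    using that by (simp add: power2_eq_square)
  have Q: "quartic s p t u (y r * q) = h r * ((1 - (y r)^2*q^2*(p*u)) * (1 - (y r)^2*q^3*(p*u)))"
    unfolding y_times_q h_eq[symmetric] unfolding power_conversions[of r]
    by (simp add: power3_eq_cube power2_eq_square mult_ac)
  have Y: "q ^ Suc r = y r * q^2" using power_conversions(3)[of r] by simp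
  show ?thesis
    unfolding off_entry_def Q Y by (rule rule[OF denominators_nonzero(3,4)])
qed

lemma dop_vec_V:
  "dop (vec_V r) = (\<lambda>i. (if r = 0 then 0 else vec_V (r - 1) i)
     + diag_entry s p t u q (y r) * vec_V r i
     + - (q ^ r * u * off_entry s p t u q (y r)) * vec_V (Suc r) i)"
  unfolding d_mat_eq by (auto simp: act_tridiag vec_V_def fun_eq_iff)

lemma dop_pow_Suc_vec_V:
  "(dop ^^ Suc n) (vec_V r) 0 = (if r = 0 then 0 else (dop ^^ n) (vec_V (r - 1)) 0)
     + diag_entry s p t u q (y r) * (dop ^^ n) (vec_V r) 0
     + - (q ^ r * u * off_entry s p t u q (y r)) * (dop ^^ n) (vec_V (Suc r)) 0"
proof -
  note lin = linear_op_funpow[OF linear_d, of n]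
  have "(dop ^^ n) (\<lambda>i. if r = 0 then 0 else v i) 0 = (if r = 0 then 0 else (dop ^^ n) v 0)" for v
    using linear_op_scale[OF lin, of 0 v] by auto
  then show ?thesis
    unfolding funpow_Suc_right o_apply dop_vec_V linear_op_add[OF lin] linear_op_scale[OF lin]
    by simp
qed

lemma d_moments: "(dop ^^ n) (vec_V r) 0 = qbin q n r * g r (n - r)"
proof (induction n arbitrary: r)
  case 0
  show ?case by (cases r) (simp_all add: vec_V_def g_def f_0_0)
next
  case (Suc n)
  have g0: "g m 0 = 1" for m using f_r_0_nonzero by (simp add: g_def)
  consider "Suc n < r" | "r = Suc n" | "r \<le> n" by linarith
  then show ?case
  proof cases
    case 1
    then show ?thesis
      unfolding dop_pow_Suc_vec_V Suc.IH by (simp add: qbin_eq_0 del: qbin.simps)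
  next
    case 2
    then show ?thesis
      unfolding dop_pow_Suc_vec_V Suc.IH
      by (simp add: qbin_eq_0 qbin_self g0 del: qbin.simps)
  next
    case 3
    define k where "k = n - r"
    define F where "F = (1 - y r * (p*u)) * h r / ((1 - (y r)^2*q*(p*u)) * (1 - (y r)^2*q^2*(p*u)))"
    define Q where "Q = (if r = 0 then 0 else qbin q n (r - 1))"
    define G where "G = (if r = 0 then 0 else g (r - 1) (Suc k))"
    have same: "q ^ r * g r (Suc k) - diag_entry s p t u q (y r) * g r k
        + q ^ r * u * F * (1 - q ^ k) * g (Suc r) (k - 1) = (1 - q ^ r) * Z r k"
      unfolding F_def by (rule g_same_level)
    have diff: "Q * G = Q * (g r (Suc k) + (1 - q ^ Suc k) * Z r k)"
    proof (cases r)
      case (Suc j)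
      then have "G = g r (Suc k) + (1 - q ^ Suc k) * Z r k"
        using g_level_difference[of j k] by (simp add: G_def algebra_simps)
      then show ?thesis by simp
    qed (simp add: Q_def)
    have absorb: "(1 - q ^ Suc r) * qbin q n (Suc r) = (1 - q ^ k) * qbin q n r"
      using qbin_absorb[OF 3] by (simp add: k_def)
    have absorb': "Q * (1 - q ^ Suc k) = (1 - q ^ r) * qbin q n r"
    proof (cases r)
      case (Suc j)
      with 3 have "n - j = Suc k" by (simp add: k_def)
      with Suc 3 qbin_absorb[of j n q] show ?thesis by (simp add: Q_def mult.commute)
    qed (simp add: Q_def)
    have pascal: "qbin q (Suc n) r = q ^ r * qbin q n r + Q"
      by (cases r) (auto simp: Q_def)
    have lower: "(if r = 0 then 0 else (dop ^^ n) (vec_V (r - 1)) 0) = Q * G"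
      using 3 by (cases r) (auto simp: Suc.IH Q_def G_def k_def Suc_diff_Suc)
    have k': "Suc n - r = Suc k" "n - Suc r = k - 1" using 3 by (auto simp: k_def)
    have calc: "Q * G + D * (b * g0) + - (x * u * (J * F)) * (b' * g2) = (x * b + Q) * g1"
      if "x * g1 - D * g0 + x * u * F * K * g2 = (1 - x) * Z" "Q * G = Q * (g1 + K' * Z)"
        "J * b' = K * b" "Q * K' = (1 - x) * b" for Q G D b g0 x J F b' g2 g1 K K' Z
    proof -
      have "Q * G + D * (b * g0) + - (x * u * (J * F)) * (b' * g2)
          = Q * G + b * (D * g0) - x * u * F * g2 * (J * b')"
        by (simp add: algebra_simps)
      also have "\<dots> = Q * g1 + Q * K' * Z + b * (D * g0 - x * u * F * K * g2)"
        unfolding that(2,3) by (simp add: algebra_simps)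
      also have "D * g0 - x * u * F * K * g2 = x * g1 - (1 - x) * Z"
        unfolding that(1)[symmetric] by simp
      finally show ?thesis unfolding that(4) by (simp add: algebra_simps)
    qed
    show ?thesis
      unfolding dop_pow_Suc_vec_V Suc.IH[of r] Suc.IH[of "Suc r"] lower pascal k' off_entry_eq_h
        F_def[symmetric] k_def[symmetric]
      by (rule calc[OF same diff absorb absorb'])
  qed
qed

abbreviation "D \<equiv> D_mat a b c d q"
abbreviation "E \<equiv> E_mat a b c d q"
abbreviation "A \<equiv> A_mat a b c d q"

lemma D_mat_eq: "D = (\<lambda>i j. 1 / (1 - q) * imat_one i j + 1 / (1 - q) * d_mat a b c d q i j)"
  and E_mat_eq: "E = (\<lambda>i j. 1 / (1 - q) * imat_one i j + 1 / (1 - q) * e_mat a b c d q i j)"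
  and A_mat_eq: "A = (\<lambda>i j. 1 * imat_mult D E i j + (-1) * imat_mult E D i j)"
  by (simp_all add: D_mat_def E_mat_def A_mat_def distrib_left)

lemma row_finite_d: "row_finite (d_mat a b c d q)" and row_finite_e: "row_finite (e_mat a b c d q)"
  unfolding d_mat_def e_mat_def by (rule row_finite_tridiag)+

lemma row_finite_D: "row_finite D" and row_finite_E: "row_finite E"
  unfolding D_mat_eq E_mat_eq
  by (intro row_finite_combination row_finite_one row_finite_d row_finite_e)+

lemma row_finite_A: "row_finite A"
  unfolding A_mat_eq by (intro row_finite_combination row_finite_mult row_finite_D row_finite_E)

lemma act_D: "act D v = (\<lambda>i. 1 / (1 - q) * v i + 1 / (1 - q) * dop v i)"
  unfolding D_mat_eq act_combination[OF row_finite_one row_finite_d] act_one ..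

lemma act_E: "act E v = (\<lambda>i. 1 / (1 - q) * v i + 1 / (1 - q) * eop v i)"
  unfolding E_mat_eq act_combination[OF row_finite_one row_finite_e] act_one ..

lemma act_A: "act A v = (\<lambda>i. 1 / (1 - q) * B v i)"
proof
  fix i
  let ?b = "1 / (1 - q)"
  have "act A v i = act D (act E v) i - act E (act D v) i"
    unfolding A_mat_eq
      act_combination[OF row_finite_mult[OF row_finite_D row_finite_E] row_finite_mult[OF row_finite_E row_finite_D]]
      act_mult[OF row_finite_D row_finite_E] act_mult[OF row_finite_E row_finite_D]
    by simp
  also have "\<dots> = ?b * ?b * (dop (eop v) i - eop (dop v) i)"
    unfolding act_D act_E linear_op_combination[OF linear_d] linear_op_combination[OF linear_e]
    by (simp add: algebra_simps)
  also have "dop (eop v) i - eop (dop v) i = (1 - q) * B v i"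
    by (simp add: commutation B_def algebra_simps)
  finally show "act A v i = ?b * B v i"
    using q_neq_1 by simp
qed

lemma act_D_pow:
  "(act D ^^ N) v = (\<lambda>i. (1 / (1 - q)) ^ N * (\<Sum>n\<le>N. of_nat (N choose n) * (dop ^^ n) v i))"
proof (induction N)
  case (Suc N)
  show ?case
    unfolding funpow.simps o_apply Suc.IH unfolding act_D linear_op_scale[OF linear_d]
      linear_op_sum[OF linear_d] binomial_sum_Suc
    by (simp add: algebra_simps)
qed simp

lemma act_A_pow: "(act A ^^ r) v = (\<lambda>i. (1 / (1 - q)) ^ r * (B ^^ r) v i)"
proof (induction r)
  case (Suc r)
  show ?case
    unfolding funpow.simps o_apply Suc.IH unfolding act_A linear_op_scale[OF linear_B] by simp
qed simp

lemma coeff_act_y_pencil_pow: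
  "coeff ((act (y_pencil D (\<lambda>i j. \<alpha> * A i j)) ^^ N) (vec_V 0) i) m
    = (1 / (1 - q)) ^ N * \<alpha> ^ m * (\<Sum>n\<le>N. of_nat (N choose n) * pencil_coeff n m i)"
proof (induction N arbitrary: m i)
  case 0
  show ?case by (simp add: pencil_coeff_0 vec_V_def)
next
  case (Suc N)
  have scaled: "row_finite (\<lambda>i j. \<alpha> * A i j)" "act (\<lambda>i j. \<alpha> * A i j) v = (\<lambda>i. \<alpha> * act A v i)" for v
    using row_finite_combination[OF row_finite_A row_finite_A, of \<alpha> 0]
      act_combination[OF row_finite_A row_finite_A, of \<alpha> 0] by simp_all
  show ?case
    unfolding funpow.simps o_apply coeff_act_y_pencil[OF row_finite_D scaled(1)] scaled(2) Suc.IH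
      act_D act_A linear_op_scale[OF linear_d] linear_op_scale[OF linear_B]
      linear_op_sum[OF linear_d] linear_op_sum[OF linear_B] binomial_sum_Suc pencil_coeff_Suc
    by (cases m) (simp_all add: algebra_simps sum.distrib)
qed

lemma D_pow_moment_eq_pencil_coeff:
  "bracket vec_W (imat_pow D N) (vec_V r) * \<alpha> ^ r * (1 - q) ^ r
    = coeff (smult (1 / bracket vec_W (imat_pow A r) (vec_V 0))
        (bracket vec_W (imat_pow (y_pencil D (\<lambda>i j. \<alpha> * A i j)) N) (vec_V 0))) r"
proof -
  have "row_finite (\<lambda>i j. \<alpha> * A i j)"
    using row_finite_combination[OF row_finite_A row_finite_A, of \<alpha> 0] by simp
  then have pencil: "row_finite (y_pencil D (\<lambda>i j. \<alpha> * A i j))"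
    by (rule row_finite_y_pencil[OF row_finite_D])
  have A: "(B ^^ r) (vec_V 0) 0 = f r 0"
    by (simp add: f_def)
  have pc: "pencil_coeff n r 0 = f r 0 * (qbin q n r * g r (n - r))" for n
    using f_r_0_nonzero by (simp add: pencil_coeff_def g_def f_def)
  have sum: "(\<Sum>n\<le>N. of_nat (N choose n) * pencil_coeff n r 0)
      = f r 0 * (\<Sum>n\<le>N. of_nat (N choose n) * (qbin q n r * g r (n - r)))"
    unfolding pc by (simp add: sum_distrib_left mult_ac)
  show ?thesis
    unfolding bracket_pow[OF row_finite_D] bracket_pow[OF row_finite_A] bracket_pow[OF pencil]
      coeff_smult coeff_act_y_pencil_pow act_D_pow act_A_pow A d_moments sum
    using f_r_0_nonzero[of r] q_neq_1 by (simp add: field_simps)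
qed

end

theorem theorem6p7:
  fixes a b c d q \<alpha> :: complex and N r :: nat
  assumes "generic_params a b c d q"
    and "\<alpha> = (1 - q) / (1 + a*c + a + c)"
  shows "bracket vec_W (imat_pow (D_mat a b c d q) N) (vec_V r) * \<alpha> ^ r * (1 - q) ^ r
    = coeff (smult (1 / bracket vec_W (imat_pow (A_mat a b c d q) r) (vec_V 0))
        (bracket vec_W
          (imat_pow (y_pencil (D_mat a b c d q) (\<lambda>i j. \<alpha> * A_mat a b c d q i j)) N)
          (vec_V 0))) r"
proof -
  interpret askey_wilson_generic a b c d q
    by unfold_locales (rule assms)
  show ?thesis by (rule D_pow_moment_eq_pencil_coeff)
qed

end
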